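(* Let $\theta$ be one of the admissible $2\times 2$ matrices and let $G(\theta)=\mathbb{R}\times_\rho\mathbb{R}^2$ be the associated 3-dimensional Lie group. For every simple almost-Riemannian structure (ARS) $\Sigma=\{\mathcal{X},\Delta^L\}$ on $G(\theta)$, the singular locus $\mathcal{Z}=\{(t,v)\in G(\theta):\ \mathcal{X}(t,v)\in\Delta^L(t,v)\}$ is an embedded submanifold of $G(\theta)$.
   Context: Admissible matrices: $\theta$ is a real $2\times2$ matrix of one of the types $\begin{pmatrix}1&1\\0&1\end{pmatrix}$; $\begin{pmatrix}1&0\\0&\lambda\end{pmatrix}$ with $\lambda\in[-1,1]$; $\begin{pmatrix}\lambda&-1\\1&\lambda\end{pmatrix}$ with $\lambda\in\mathbb{R}$. $\mathfrak{g}(\theta)=\mathbb{R}\times_\theta\mathbb{R}^2$ is the 3-dimensional Lie algebra on $\mathbb{R}\times\mathbb{R}^2$ with bracket $[(a_1,w_1),(a_2,w_2)]=(0,\,a_1\theta w_2-a_2\theta w_1)$. $G(\theta)=\mathbb{R}\times_\rho\mathbb{R}^2$ is the connected, simply connected Lie group with Lie algebra $\mathfrak{g}(\theta)$ and product $(t_1,v_1)(t_2,v_2)=(t_1+t_2,\,v_1+\rho_{t_1}v_2)$, where $\rho_t=e^{t\theta}$. For a $2\times 2$ matrix $B$, $\Lambda^B_t w=\int_0^t e^{sB}w\,ds$. Linear vector fields: a vector field $\mathcal{X}$ on $G(\theta)$ is linear if it is complete and its flow is a 1-parameter group of automorphisms of $G(\theta)$. These are exactly the vector fields $\mathcal{X}(t,v)=(0,\,Av+\Lambda_t^\theta\xi)$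 with $\xi\in\mathbb{R}^2$, $A\in\mathfrak{gl}(2,\mathbb{R})$, $A\theta=\theta A$; one writes $\mathcal{X}=(\xi,A)$. The associated derivation of $\mathfrak{g}(\theta)$ is $\mathcal{D}(a,w)=(0,\,a\xi+Aw)$. Left-invariant distributions: for a 2-dimensional subspace $\Delta\subset\mathfrak{g}(\theta)$, $\Delta^L(t,v)=(dL_{(t,v)})_{(0,0)}\Delta=\{(a,\rho_t w):(a,w)\in\Delta\}$. An inner product on $\Delta$ induces a left-invariant Euclidean metric on $\Delta^L$. LARC: $\Sigma=\{\mathcal{X},\Delta^L\}$ satisfies the Lie algebra rank condition (LARC) if either $\Delta$ is not a subalgebra of $\mathfrak{g}(\theta)$, or $\Delta$ is a subalgebra and $\mathcal{D}\Delta\not\subset\Delta$. Simple ARS: a simple ARS (also called just an ARS) on $G(\theta)$ is a family $\Sigma=\{\mathcal{X},\Delta^L\}$ with $\mathcal{X}$ a linear vector field and $\Delta^L$ a 2-dimensional left-invariant distribution with a left-invariant Euclidean metric, such that (i) $\{(t,v):\mathcal{X}(t,v)\notin\Delta^L(t,v)\}\neq\emptyset$ and (ii) $\Sigma$ satisfies the LARC. *)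

theory Defs
  imports "HOL-Analysis.Analysis"
begin

section \<open>Smooth maps and embedded submanifolds of Euclidean spaces\<close>

text \<open>Both notions are meant for open \<open>S\<close>: differentiability is two-sided, as in \<open>at x\<close>.\<close>

primrec Ck_on :: "nat \<Rightarrow> 'a::real_normed_vector set \<Rightarrow> ('a \<Rightarrow> 'b::real_normed_vector) \<Rightarrow> bool" where
  "Ck_on 0 S f \<longleftrightarrow> continuous_on S f"
| "Ck_on (Suc k) S f \<longleftrightarrow> (\<forall>x\<in>S. f differentiable (at x)) \<and>
     (\<forall>v. Ck_on k S (\<lambda>x. frechet_derivative f (at x) v))"

definition smooth_on :: "'a::real_normed_vector set \<Rightarrow> ('a \<Rightarrow> 'b::real_normed_vector) \<Rightarrow> bool" where
  "smooth_on S f \<longleftrightarrow> (\<forall>k. Ck_on k S f)"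

definition diffeomorphism_on ::
    "'a::real_normed_vector set \<Rightarrow> 'b::real_normed_vector set \<Rightarrow> ('a \<Rightarrow> 'b) \<Rightarrow> bool" where
  "diffeomorphism_on U V f \<longleftrightarrow> bij_betw f U V \<and> smooth_on U f \<and> smooth_on V (inv_into U f)"

text \<open>Slice charts: around each of its points, \<open>S\<close> is carried by a smooth chart of the ambient
  space to an open piece of a \<open>k\<close>-dimensional linear subspace, with the same \<open>k\<close> at all points.
  The slice model is a subspace \<open>W\<close> instead of \<open>\<real>\<^sup>k \<times> {0}\<close> because the basis of a Euclidean
  space is not ordered; a linear change of coordinates turns one into the other.\<close>

definition embedded_submanifold_dim :: "nat \<Rightarrow> 'a::euclidean_space set \<Rightarrow> bool" where
  "embedded_submanifold_dim k S \<longleftrightarrow>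
     (\<forall>p\<in>S. \<exists>U V (f :: 'a \<Rightarrow> 'a) W. open U \<and> p \<in> U \<and> open V \<and> diffeomorphism_on U V f \<and>
        subspace W \<and> dim W = k \<and> f ` (S \<inter> U) = V \<inter> W)"

definition embedded_submanifold :: "'a::euclidean_space set \<Rightarrow> bool" where
  "embedded_submanifold S \<longleftrightarrow> (\<exists>k. embedded_submanifold_dim k S)"


section \<open>The Lie algebra and the Lie group\<close>

definition admissible :: "real^2^2 \<Rightarrow> bool" where
  "admissible \<theta> \<longleftrightarrow>
     \<theta> = vector [vector [1, 1], vector [0, 1]] \<or>
     (\<exists>l. -1 \<le> l \<and> l \<le> 1 \<and> \<theta> = vector [vector [1, 0], vector [0, l]]) \<or>
     (\<exists>l. \<theta> = vector [vector [l, -1], vector [1, l]])"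

text \<open>The power series is written out since the library's \<open>exp\<close> needs a Banach algebra, and
  \<open>*\<close> on \<open>real^2^2\<close> is the componentwise product.\<close>

definition mexp :: "real^2^2 \<Rightarrow> real^2^2" where
  "mexp B = (\<Sum>n. (1 / fact n) *\<^sub>R (((**) B ^^ n) (mat 1)))"

abbreviation rho :: "real^2^2 \<Rightarrow> real \<Rightarrow> real^2^2" where
  "rho \<theta> t \<equiv> mexp (t *\<^sub>R \<theta>)"

text \<open>The integral is oriented, so that negative \<open>t\<close> are covered.\<close>

definition Lam :: "real^2^2 \<Rightarrow> real \<Rightarrow> real^2 \<Rightarrow> real^2" where
  "Lam B t w = (LBINT s=ereal 0..ereal t. mexp (s *\<^sub>R B) *v w)"

text \<open>The manifold underlying \<open>G(\<theta>)\<close> is \<open>\<real> \<times> \<real>\<^sup>2\<close>, and \<open>(0, 0)\<close> is the identity. This global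
  chart identifies every tangent space, and in particular the Lie algebra, with \<open>\<real> \<times> \<real>\<^sup>2\<close>.\<close>

type_synonym pt = "real \<times> (real^2)"

definition bracket :: "real^2^2 \<Rightarrow> pt \<Rightarrow> pt \<Rightarrow> pt" where
  "bracket \<theta> x y = (0, fst x *\<^sub>R (\<theta> *v snd y) - fst y *\<^sub>R (\<theta> *v snd x))"

definition gmult :: "real^2^2 \<Rightarrow> pt \<Rightarrow> pt \<Rightarrow> pt" where
  "gmult \<theta> p q = (fst p + fst q, snd p + rho \<theta> (fst p) *v snd q)"

definition lie_automorphism :: "real^2^2 \<Rightarrow> (pt \<Rightarrow> pt) \<Rightarrow> bool" where
  "lie_automorphism \<theta> f \<longleftrightarrow> diffeomorphism_on UNIV UNIV f \<and>
     (\<forall>p q. f (gmult \<theta> p q) = gmult \<theta> (f p) (f q))"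

definition lie_subalgebra :: "real^2^2 \<Rightarrow> pt set \<Rightarrow> bool" where
  "lie_subalgebra \<theta> \<Delta> \<longleftrightarrow> subspace \<Delta> \<and> (\<forall>x\<in>\<Delta>. \<forall>y\<in>\<Delta>. bracket \<theta> x y \<in> \<Delta>)"


section \<open>Linear vector fields\<close>

definition global_flow :: "(pt \<Rightarrow> pt) \<Rightarrow> (real \<Rightarrow> pt \<Rightarrow> pt) \<Rightarrow> bool" where
  "global_flow X \<phi> \<longleftrightarrow> (\<forall>p. \<phi> 0 p = p) \<and>
     (\<forall>s p. ((\<lambda>r. \<phi> r p) has_vector_derivative X (\<phi> s p)) (at s))"

definition linear_vector_field :: "real^2^2 \<Rightarrow> (pt \<Rightarrow> pt) \<Rightarrow> bool" where
  "linear_vector_field \<theta> X \<longleftrightarrow> smooth_on UNIV X \<and>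
     (\<exists>\<phi>. global_flow X \<phi> \<and> (\<forall>r s. \<phi> (r + s) = \<phi> r \<circ> \<phi> s) \<and> (\<forall>s. lie_automorphism \<theta> (\<phi> s)))"

definition field_of :: "real^2^2 \<Rightarrow> real^2 \<Rightarrow> real^2^2 \<Rightarrow> pt \<Rightarrow> pt" where
  "field_of \<theta> \<xi> A p = (0, A *v snd p + Lam \<theta> (fst p) \<xi>)"

definition derivation_of :: "real^2 \<Rightarrow> real^2^2 \<Rightarrow> pt \<Rightarrow> pt" where
  "derivation_of \<xi> A x = (0, fst x *\<^sub>R \<xi> + A *v snd x)"

text \<open>For admissible \<open>\<theta>\<close> every linear vector field is \<open>field_of \<theta> \<xi> A\<close> for some \<open>\<xi>\<close> and some
  \<open>A\<close> commuting with \<open>\<theta>\<close>. The pair is unique, so the description is a proper one: see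
  \<open>associated_derivation_field_of\<close> below.\<close>

definition associated_derivation :: "real^2^2 \<Rightarrow> (pt \<Rightarrow> pt) \<Rightarrow> pt \<Rightarrow> pt" where
  "associated_derivation \<theta> X =
     (THE D. \<exists>\<xi> A. A ** \<theta> = \<theta> ** A \<and> X = field_of \<theta> \<xi> A \<and> D = derivation_of \<xi> A)"


section \<open>Left-invariant distributions and simple almost-Riemannian structures\<close>

definition dL :: "real^2^2 \<Rightarrow> pt \<Rightarrow> pt \<Rightarrow> pt" where
  "dL \<theta> p = frechet_derivative (gmult \<theta> p) (at (0, 0))"

definition left_dist :: "real^2^2 \<Rightarrow> pt set \<Rightarrow> pt \<Rightarrow> pt set" where
  "left_dist \<theta> \<Delta> p = dL \<theta> p ` \<Delta>"

definition inner_product_on :: "'a::real_vector set \<Rightarrow> ('a \<Rightarrow> 'a \<Rightarrow> real) \<Rightarrow> bool" where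
  "inner_product_on V m \<longleftrightarrow>
     (\<forall>x\<in>V. \<forall>y\<in>V. m x y = m y x) \<and>
     (\<forall>x\<in>V. \<forall>y\<in>V. \<forall>z\<in>V. \<forall>a b. m (a *\<^sub>R x + b *\<^sub>R y) z = a * m x z + b * m y z) \<and>
     (\<forall>x\<in>V. x \<noteq> 0 \<longrightarrow> m x x > 0)"

text \<open>\<open>g p\<close> is the inner product on the plane \<open>left_dist \<theta> \<Delta> p\<close>; its values on vectors outside
  that plane are irrelevant.\<close>

definition left_invariant_metric ::
    "real^2^2 \<Rightarrow> pt set \<Rightarrow> (pt \<Rightarrow> pt \<Rightarrow> pt \<Rightarrow> real) \<Rightarrow> bool" where
  "left_invariant_metric \<theta> \<Delta> g \<longleftrightarrow>
     (\<exists>m. inner_product_on \<Delta> m \<and> (\<forall>p. \<forall>x\<in>\<Delta>. \<forall>y\<in>\<Delta>. g p (dL \<theta> p x) (dL \<theta> p y) = m x y))"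

definition LARC :: "real^2^2 \<Rightarrow> (pt \<Rightarrow> pt) \<Rightarrow> pt set \<Rightarrow> bool" where
  "LARC \<theta> X \<Delta> \<longleftrightarrow> \<not> lie_subalgebra \<theta> \<Delta> \<or>
     (lie_subalgebra \<theta> \<Delta> \<and> \<not> associated_derivation \<theta> X ` \<Delta> \<subseteq> \<Delta>)"

definition simple_ARS ::
    "real^2^2 \<Rightarrow> (pt \<Rightarrow> pt) \<Rightarrow> pt set \<Rightarrow> (pt \<Rightarrow> pt \<Rightarrow> pt \<Rightarrow> real) \<Rightarrow> bool" where
  "simple_ARS \<theta> X \<Delta> g \<longleftrightarrow>
     linear_vector_field \<theta> X \<and>
     subspace \<Delta> \<and> dim \<Delta> = 2 \<and> left_invariant_metric \<theta> \<Delta> g \<and>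
     {p. X p \<notin> left_dist \<theta> \<Delta> p} \<noteq> {} \<and>
     LARC \<theta> X \<Delta>"

definition singular_locus :: "real^2^2 \<Rightarrow> (pt \<Rightarrow> pt) \<Rightarrow> pt set \<Rightarrow> pt set" where
  "singular_locus \<theta> X \<Delta> = {p. X p \<in> left_dist \<theta> \<Delta> p}"


section \<open>Consistency of the definitions\<close>

lemma dL_eq: "dL \<theta> p x = (fst x, rho \<theta> (fst p) *v snd x)"
proof -
  have "(gmult \<theta> p has_derivative (\<lambda>x. (fst x, rho \<theta> (fst p) *v snd x))) (at (0, 0))"
    unfolding gmult_def
    by (auto intro!: derivative_eq_intros
        bounded_linear.has_derivative[OF matrix_vector_mul_bounded_linear])
  from frechet_derivative_at[OF this] show ?thesis
    unfolding dL_def by (rule fun_cong[OF sym])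
qed

lemma left_dist_eq: "left_dist \<theta> \<Delta> (t, v) = {(a, rho \<theta> t *v w) | a w. (a, w) \<in> \<Delta>}"
proof -
  have "dL \<theta> (t, v) = (\<lambda>(a, w). (a, rho \<theta> t *v w))"
    by (rule ext) (simp add: dL_eq case_prod_unfold)
  then show ?thesis unfolding left_dist_def by (auto intro: rev_image_eqI)
qed

lemma mexp_zero: "mexp 0 = mat 1"
proof -
  have 0: "((**) (0::real^2^2) ^^ n) (mat 1) = (if n = 0 then mat 1 else 0)" for n
    by (cases n) auto
  have "(\<lambda>n. (1 / fact n) *\<^sub>R (((**) (0::real^2^2) ^^ n) (mat 1)))
      = (\<lambda>n. if n = 0 then mat 1 else 0)"
    by (auto simp: 0)
  then show ?thesis
    unfolding mexp_def using sums_single[of 0 "\<lambda>_. mat 1 :: real^2^2"] sums_unique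
    by (metis (no_types, lifting))
qed

lemma continuous_on_rho: "continuous_on S (\<lambda>s. rho B s)"
proof -
  define L where "L = (\<lambda>C::real^2^2. B ** C)"
  have linL: "linear L"
    unfolding L_def
    by (rule linearI) (simp_all only: matrix_add_ldistrib matrix_scalar_ac scalar_matrix_assoc)
  obtain K where K: "K > 0" "\<And>C. norm (L C) \<le> norm C * K"
    using bounded_linear.pos_bounded[OF linL[unfolded linear_conv_bounded_linear]] by blast
  define c where "c n = (L ^^ n) (mat 1)" for n
  have c: "norm (c n) \<le> K ^ n * norm (mat 1 :: real^2^2)" for n
  proof (induction n)
    case (Suc n)
    have "norm (c (Suc n)) \<le> norm (c n) * K" using K(2)[of "c n"] by (simp add: c_def)
    also have "\<dots> \<le> (K ^ n * norm (mat 1 :: real^2^2)) * K"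
      using Suc K(1) by (intro mult_right_mono) auto
    finally show ?case by (simp add: algebra_simps)
  qed (simp add: c_def)
  have pw: "((**) (s *\<^sub>R B) ^^ n) (mat 1) = s ^ n *\<^sub>R c n" for s n
  proof (induction n)
    case (Suc n)
    have "((**) (s *\<^sub>R B) ^^ Suc n) (mat 1) = (s *\<^sub>R B) ** (s ^ n *\<^sub>R c n)"
      by (simp add: Suc)
    also have "\<dots> = s *\<^sub>R L (s ^ n *\<^sub>R c n)"
      unfolding L_def by (simp only: scalar_matrix_assoc)
    also have "\<dots> = s ^ Suc n *\<^sub>R c (Suc n)"
      by (simp add: linear_cmul[OF linL] c_def)
    finally show ?case .
  qed (simp add: c_def)
  have rho: "continuous_on {-r<..<r} (\<lambda>s. rho B s)" for r :: real
  proof -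
    have "uniform_limit {-r<..<r} (\<lambda>n s. \<Sum>i<n. (1 / fact i) *\<^sub>R (s ^ i *\<^sub>R c i))
        (\<lambda>s. \<Sum>i. (1 / fact i) *\<^sub>R (s ^ i *\<^sub>R c i)) sequentially"
    proof (rule Weierstrass_m_test)
      fix n s assume s: "s \<in> {-r<..<r}"
      have "norm ((1 / fact n) *\<^sub>R (s ^ n *\<^sub>R c n)) = (1 / fact n) * (\<bar>s\<bar> ^ n * norm (c n))"
        by (simp add: power_abs)
      also have "\<dots> \<le> (1 / fact n) * (r ^ n * (K ^ n * norm (mat 1 :: real^2^2)))"
        using s c[of n] by (intro mult_left_mono mult_mono power_mono) auto
      also have "\<dots> = (inverse (fact n) * (r * K) ^ n) * norm (mat 1 :: real^2^2)"
        by (simp add: power_mult_distrib field_simps)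
      finally show "norm ((1 / fact n) *\<^sub>R (s ^ n *\<^sub>R c n))
          \<le> (inverse (fact n) * (r * K) ^ n) * norm (mat 1 :: real^2^2)" .
    next
      show "summable (\<lambda>n. (inverse (fact n) * (r * K) ^ n) * norm (mat 1 :: real^2^2))"
        by (intro summable_mult2 summable_exp)
    qed
    then have "continuous_on {-r<..<r} (\<lambda>s. \<Sum>i. (1 / fact i) *\<^sub>R (s ^ i *\<^sub>R c i))"
      by (rule uniform_limit_theorem[rotated]) (auto intro!: continuous_intros always_eventually)
    then show ?thesis by (simp add: mexp_def pw)
  qed
  have "isCont (\<lambda>s. rho B s) x" for x
    by (rule continuous_on_interior[OF rho[of "\<bar>x\<bar> + 1"]]) auto
  then show ?thesis by (simp add: continuous_at_imp_continuous_on)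
qed

lemma Lam_zero: "Lam B 0 w = 0"
  unfolding Lam_def by (rule interval_integral_endpoints_same)

lemma Lam_has_vector_derivative: "((\<lambda>t. Lam B t w) has_vector_derivative w) (at 0)"
proof -
  have "linear (\<lambda>M::real^2^2. M *v w)"
    by (rule linearI) (simp_all only: matrix_vector_mult_add_rdistrib scaleR_matrix_vector_assoc)
  then have cont: "continuous_on {-1..1} (\<lambda>s. rho B s *v w)"
    by (intro bounded_linear.continuous_on[OF _ continuous_on_rho])
       (simp add: linear_conv_bounded_linear)
  have "((\<lambda>u. LBINT y=ereal 0..u. rho B y *v w) has_vector_derivative (rho B 0 *v w))
      (at 0 within {-1..1})"
    by (rule interval_integral_FTC2[OF _ _ cont]) auto
  moreover have "at 0 within {-1..1} = (at 0 :: real filter)"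
    by (rule at_within_interior) simp
  moreover have "rho B 0 *v w = w"
    by (simp add: mexp_zero)
  ultimately show ?thesis
    unfolding Lam_def by (simp only:)
qed

lemma associated_derivation_field_of:
  assumes "A ** \<theta> = \<theta> ** A"
  shows "associated_derivation \<theta> (field_of \<theta> \<xi> A) = derivation_of \<xi> A"
  unfolding associated_derivation_def
proof (rule the_equality)
  fix D assume "\<exists>\<eta> B. B ** \<theta> = \<theta> ** B \<and> field_of \<theta> \<xi> A = field_of \<theta> \<eta> B \<and> D = derivation_of \<eta> B"
  then obtain \<eta> B where eq: "field_of \<theta> \<xi> A = field_of \<theta> \<eta> B" and D: "D = derivation_of \<eta> B"
    by blast
  have "A *v v = B *v v" for v
    using fun_cong[OF eq, of "(0, v)"] by (simp add: field_of_def Lam_zero)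
  then have "A = B" by (simp add: matrix_eq)
  moreover have "Lam \<theta> t \<xi> = Lam \<theta> t \<eta>" for t
    using fun_cong[OF eq, of "(t, 0)"] by (simp add: field_of_def)
  then have "\<xi> = \<eta>"
    using Lam_has_vector_derivative[of \<theta> \<xi>] Lam_has_vector_derivative[of \<theta> \<eta>]
    by (auto intro: vector_derivative_unique_at)
  ultimately show "D = derivation_of \<xi> A" using D by simp
qed (use assms in blast)

end

theory Submission
  imports Defs
begin

text \<open>Differentiating \<open>\<phi>\<^sub>s (p q) = \<phi>\<^sub>s p \<phi>\<^sub>s q\<close> at \<open>s = 0\<close> shows that a linear vector field has the form
  \<open>(t, v) \<mapsto> (0, A v + \<Lambda>\<^sub>t \<xi>)\<close> with \<open>A \<theta> = \<theta> A\<close>. If \<open>(n\<^sub>0, n)\<close> is normal to \<open>\<Delta>\<close>, the singular locus is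
  the zero set of \<open>F (t, v) = n \<bullet> \<rho>\<^sub>-\<^sub>t (A v + \<Lambda>\<^sub>t \<xi>) = m \<bullet> \<rho>\<^sub>-\<^sub>t v + c t\<close>, where \<open>m = A\<^sup>T n\<close> and
  \<open>c' t = n \<bullet> \<rho>\<^sub>-\<^sub>t \<xi>\<close>. If \<open>m \<noteq> 0\<close>, a global chart \<open>(t, v) \<mapsto> (t, \<rho>\<^sub>-\<^sub>t v + d t)\<close> maps it to a plane.
  If \<open>m = 0\<close>, it is the union of the planes \<open>{t} \<times> \<real>\<^sup>2\<close> with \<open>c t = 0\<close>; here \<open>c\<close> is not identically
  zero, and its zeros are isolated because by Cayley-Hamilton \<open>c'\<close> solves a linear second order
  equation.\<close>

section \<open>Smooth maps\<close>

text \<open>Openness of \<open>S\<close> makes each derivative at a point of \<open>S\<close> depend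
  on values in \<open>S\<close> alone. The induction generalises over the functions, because the
  derivatives form the next pair.\<close>

lemma Ck_on_cong:
  assumes "open S" and "\<And>x. x \<in> S \<Longrightarrow> f x = g x"
  shows "Ck_on k S f \<longleftrightarrow> Ck_on k S g"
proof -
  have "Ck_on k S g" if "Ck_on k S f" "\<And>x. x \<in> S \<Longrightarrow> f x = g x" for f g :: "'a \<Rightarrow> 'b"
    using that
  proof (induction k arbitrary: f g)
    case 0
    then show ?case by (simp cong: continuous_on_cong)
  next
    case (Suc k)
    have d: "(g has_derivative frechet_derivative f (at x)) (at x)" if "x \<in> S" for x
    proof (rule has_derivative_transform_within_open[OF _ \<open>open S\<close> that])
      show "(f has_derivative frechet_derivative f (at x)) (at x)"
        using Suc.prems(1) that frechet_derivative_works by auto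
    qed (use Suc.prems(2) in auto)
    have "Ck_on k S (\<lambda>x. frechet_derivative g (at x) v)" for v
    proof (rule Suc.IH)
      show "Ck_on k S (\<lambda>x. frechet_derivative f (at x) v)" using Suc.prems(1) by simp
      show "frechet_derivative f (at x) v = frechet_derivative g (at x) v" if "x \<in> S" for x
        using frechet_derivative_at[OF d[OF that]] by simp
    qed
    then show ?case using d by (auto simp: differentiable_def)
  qed
  from this[of f g] this[of g f] assms(2) show ?thesis by metis
qed

text \<open>Lets any explicit derivative stand in for \<open>frechet_derivative\<close>, by
  uniqueness of derivatives at points of \<open>S\<close>.\<close>

lemma Ck_on_SucI:
  assumes "open S" and d: "\<And>x. x \<in> S \<Longrightarrow> (f has_derivative f' x) (at x)"
    and "\<And>v. Ck_on k S (\<lambda>x. f' x v)"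
  shows "Ck_on (Suc k) S f"
proof -
  have "Ck_on k S (\<lambda>x. frechet_derivative f (at x) v)" for v
    using assms(3)[of v] Ck_on_cong[OF \<open>open S\<close>, of "\<lambda>x. f' x v"]
    by (metis (no_types, lifting) d frechet_derivative_at)
  then show ?thesis using d by (auto simp: differentiable_def)
qed

lemma Ck_on_SucD:
  assumes "Ck_on (Suc k) S f"
  shows "x \<in> S \<Longrightarrow> (f has_derivative frechet_derivative f (at x)) (at x)"
    and "Ck_on k S (\<lambda>x. frechet_derivative f (at x) v)"
  using assms frechet_derivative_works by auto

lemma Ck_on_Suc_imp: "Ck_on (Suc k) S f \<Longrightarrow> Ck_on k S f"
proof (induction k arbitrary: f)
  case 0
  then show ?case
    by (auto intro!: continuous_at_imp_continuous_on differentiable_imp_continuous_within)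
next
  case (Suc k)
  then show ?case by (metis Ck_on.simps(2))
qed

lemma Ck_on_const: "Ck_on k S (\<lambda>x. c)"
proof (induction k arbitrary: c)
  case (Suc k)
  then show ?case by simp
qed simp

lemma Ck_on_bounded_linear:
  assumes "bounded_linear h" "open S" shows "Ck_on k S h"
proof (cases k)
  case 0
  then show ?thesis using assms by (simp add: linear_continuous_on)
next
  case (Suc j)
  then show ?thesis
    using assms by (auto intro!: Ck_on_SucI Ck_on_const bounded_linear_imp_has_derivative
        simp del: Ck_on.simps)
qed

lemma Ck_on_bounded_linear_compose:
  assumes "bounded_linear h" "open S" "Ck_on k S f"
  shows "Ck_on k S (\<lambda>x. h (f x))"
  using assms(3)
proof (induction k arbitrary: f)
  case 0
  then show ?case using assms(1) by (auto intro: bounded_linear.continuous_on)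
next
  case (Suc k)
  show ?case
  proof (rule Ck_on_SucI[OF \<open>open S\<close>])
    show "((\<lambda>x. h (f x)) has_derivative (\<lambda>v. h (frechet_derivative f (at x) v))) (at x)"
      if "x \<in> S" for x
      using bounded_linear.has_derivative[OF assms(1)] Ck_on_SucD(1)[OF Suc.prems that] by blast
    show "Ck_on k S (\<lambda>x. h (frechet_derivative f (at x) v))" for v
      by (rule Suc.IH) (rule Ck_on_SucD(2)[OF Suc.prems])
  qed
qed

lemma Ck_on_add:
  assumes "open S" "Ck_on k S f" "Ck_on k S g"
  shows "Ck_on k S (\<lambda>x. f x + g x)"
  using assms(2,3)
proof (induction k arbitrary: f g)
  case 0
  then show ?case by (auto intro: continuous_intros)
next
  case (Suc k)
  show ?case
  proof (rule Ck_on_SucI[OF \<open>open S\<close>])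
    show "((\<lambda>x. f x + g x) has_derivative
        (\<lambda>v. frechet_derivative f (at x) v + frechet_derivative g (at x) v)) (at x)"
      if "x \<in> S" for x
      using Ck_on_SucD(1)[OF Suc.prems(1) that] Ck_on_SucD(1)[OF Suc.prems(2) that]
      by (rule has_derivative_add)
    show "Ck_on k S (\<lambda>x. frechet_derivative f (at x) v + frechet_derivative g (at x) v)" for v
      by (rule Suc.IH) (rule Ck_on_SucD(2)[OF Suc.prems(1)] Ck_on_SucD(2)[OF Suc.prems(2)])+
  qed
qed

lemma Ck_on_bilinear:
  assumes "bounded_bilinear h" "open S" "Ck_on k S f" "Ck_on k S g"
  shows "Ck_on k S (\<lambda>x. h (f x) (g x))"
  using assms(3,4)
proof (induction k arbitrary: f g)
  case 0
  then show ?case using assms(1) by (auto intro: bounded_bilinear.continuous_on)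
next
  case (Suc k)
  show ?case
  proof (rule Ck_on_SucI[OF \<open>open S\<close>])
    show "((\<lambda>x. h (f x) (g x)) has_derivative
        (\<lambda>v. h (f x) (frechet_derivative g (at x) v) + h (frechet_derivative f (at x) v) (g x)))
        (at x)" if "x \<in> S" for x
      using Ck_on_SucD(1)[OF Suc.prems(1) that] Ck_on_SucD(1)[OF Suc.prems(2) that]
      by (rule bounded_bilinear.FDERIV[OF assms(1)])
    show "Ck_on k S
        (\<lambda>x. h (f x) (frechet_derivative g (at x) v) + h (frechet_derivative f (at x) v) (g x))"
      for v
      \<comment> \<open>The product rule pairs each undifferentiated factor with a derivative of the
        other, so that factor is lowered from order \<open>Suc k\<close> to
        \<open>k\<close>.\<close>
      using Suc.prems
      by (intro Ck_on_add[OF \<open>open S\<close>] Suc.IH) (blast intro: Ck_on_SucD(2) Ck_on_Suc_imp)+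
  qed
qed

lemma Ck_on_Pair:
  assumes "open S" "Ck_on k S f" "Ck_on k S g"
  shows "Ck_on k S (\<lambda>x. (f x, g x))"
proof -
  have "Ck_on k S (\<lambda>x. (f x, 0) + (0, g x))"
    using assms
    by (intro Ck_on_add Ck_on_bounded_linear_compose[of "\<lambda>y. (y, 0)"]
        Ck_on_bounded_linear_compose[of "\<lambda>y. (0, y)"]
        bounded_linear_Pair bounded_linear_ident bounded_linear_zero)
  then show ?thesis by simp
qed

text \<open>Chain rule through \<open>fst\<close>. The gain of one order lets smoothness be read off
  a differential equation order by order.\<close>

lemma Ck_on_fst:
  fixes F :: "real \<Rightarrow> 'a::real_normed_vector"
  assumes "\<And>t. (F has_vector_derivative F' t) (at t)"
    and "Ck_on k UNIV (\<lambda>p :: real \<times> 'b::real_normed_vector. F' (fst p))"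
  shows "Ck_on (Suc k) UNIV (\<lambda>p :: real \<times> 'b. F (fst p))"
proof (rule Ck_on_SucI[OF open_UNIV])
  fix p :: "real \<times> 'b"
  have "(F has_derivative (\<lambda>h. h *\<^sub>R F' (fst p))) (at (fst p))"
    using assms(1) by (simp add: has_vector_derivative_def)
  from has_derivative_compose[OF has_derivative_fst[OF has_derivative_ident] this]
  show "((\<lambda>p. F (fst p)) has_derivative (\<lambda>v. fst v *\<^sub>R F' (fst p))) (at p)" .
qed (rule Ck_on_bounded_linear_compose[OF bounded_linear_scaleR_right open_UNIV assms(2)])

text \<open>An explicit inverse \<open>h\<close> replaces \<open>inv_into U f\<close>. The two agree
  only on \<open>V\<close>, which suffices as \<open>V\<close> is open.\<close>

lemma diffeomorphism_onI:
  assumes "open V" "f ` U = V" "\<And>x. x \<in> U \<Longrightarrow> h (f x) = x"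
    and "\<And>k. Ck_on k U f" "\<And>k. Ck_on k V h"
  shows "diffeomorphism_on U V f"
proof -
  have inj: "inj_on f U" using assms(3) by (metis inj_onI)
  have "inv_into U f y = h y" if "y \<in> V" for y
    using that assms(2,3) inj by (auto simp: inv_into_f_f)
  then have "Ck_on k V (inv_into U f)" for k
    using Ck_on_cong[OF assms(1)] assms(5) by metis
  then show ?thesis
    using inj assms(2,4) by (simp add: diffeomorphism_on_def bij_betw_def smooth_on_def)
qed


section \<open>Curves\<close>

lemma eq_if_same_vector_derivative:
  fixes f :: "real \<Rightarrow> 'a::real_normed_vector"
  assumes "\<And>t. (f has_vector_derivative d t) (at t)" "\<And>t. (g has_vector_derivative d t) (at t)"
    and "f a = g a"
  shows "f t = g t"
proof -
  have "((\<lambda>t. f t - g t) has_derivative (\<lambda>h. 0)) (at x)" for x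
    using has_vector_derivative_diff[OF assms(1)[of x] assms(2)[of x]]
    by (simp add: has_vector_derivative_def)
  from has_derivative_zero_unique[OF convex_UNIV this, of t a] assms(3) show ?thesis by simp
qed

text \<open>Additivity carries the derivative \<open>D\<close> at \<open>0\<close> to every point,
  so \<open>f - D\<close> has derivative zero everywhere and is constant.\<close>

lemma bounded_linear_if_additive_differentiable:
  assumes add: "\<And>x y. f (x + y) = f x + f y" and "f differentiable (at 0)"
  shows "bounded_linear f"
proof -
  obtain D where D: "(f has_derivative D) (at 0)"
    using assms(2) by (auto simp: differentiable_def)
  have lin: "bounded_linear D" using D by (rule has_derivative_bounded_linear)
  have "((\<lambda>y. f y - D y) has_derivative (\<lambda>h. 0)) (at x)" for x
  proof -
    have "((\<lambda>y. y - x) has_derivative (\<lambda>h. h)) (at x)"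
      by (auto intro!: derivative_eq_intros)
    then have "((\<lambda>y. f (y - x)) has_derivative D) (at x)"
      using has_derivative_compose[of "\<lambda>y. y - x" "\<lambda>h. h" x UNIV f D] D by simp
    then have "((\<lambda>y. f x + f (y - x) - D y) has_derivative (\<lambda>h. 0)) (at x)"
      by (auto intro!: derivative_eq_intros bounded_linear_imp_has_derivative lin)
    moreover have "f x + f (y - x) = f y" for y using add[of x "y - x"] by simp
    ultimately show ?thesis by simp
  qed
  from has_derivative_zero_unique[OF convex_UNIV this] have "f x - D x = f 0 - D 0" for x
    by simp
  moreover have "f 0 = 0" using add[of 0 0] by simp
  moreover have "D 0 = 0" using lin by (simp add: linear_simps)
  ultimately have "f = D" by auto
  with lin show ?thesis by simp
qed

text \<open>Rolle: a second zero of \<open>f\<close> near \<open>a\<close> would produce a zero of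
  \<open>f'\<close> strictly between them, hence near \<open>a\<close> but different from
  it.\<close>

lemma eventually_nonzero_if_deriv_nonzero:
  fixes f :: "real \<Rightarrow> real"
  assumes d: "\<And>t. (f has_real_derivative f' t) (at t)" and "f a = 0"
    and "eventually (\<lambda>t. f' t \<noteq> 0) (at a)"
  shows "eventually (\<lambda>t. f t \<noteq> 0) (at a)"
proof -
  obtain e where e: "e > 0" "\<And>t. t \<noteq> a \<Longrightarrow> dist t a < e \<Longrightarrow> f' t \<noteq> 0"
    using assms(3) by (auto simp: eventually_at)
  have "f t \<noteq> 0" if t: "t \<noteq> a" "dist t a < e" for t
  proof
    assume "f t = 0"
    define l u where "l = min a t" and "u = max a t"
    have "l < u" "f l = f u" using t \<open>f t = 0\<close> \<open>f a = 0\<close> by (auto simp: l_def u_def min_def max_def)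
    then obtain z where z: "l < z" "z < u" "f' z = 0"
      using Rolle_deriv[of l u f "\<lambda>t h. f' t * h"] d
      by (metis (no_types, lifting) DERIV_continuous_on continuous_on_subset has_field_derivative_def
          has_field_derivative_at_within mult.right_neutral)
    then have "z \<noteq> a" "dist z a < e" using t(2) by (auto simp: l_def u_def dist_real_def)
    then show False using e(2) z(3) by blast
  qed
  then show ?thesis using e(1) by (auto simp: eventually_at)
qed


section \<open>The matrix exponential\<close>

text \<open>Otherwise the simplifier pulls the sign in \<open>rho \<theta> (- t)\<close> out of the scalar product.\<close>

declare scaleR_minus_left [simp del] mexp_zero [simp]

section \<open>Matrix products as bounded bilinear maps\<close>

lemma bounded_bilinear_matrix_mult:
  "bounded_bilinear ((**) :: real^'m^'n \<Rightarrow> real^'k^'m \<Rightarrow> real^'k^'n)"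
  unfolding bilinear_conv_bounded_bilinear[symmetric] bilinear_def
  by (auto intro!: linearI simp: vec_eq_iff matrix_matrix_mult_def sum.distrib sum_distrib_left
      algebra_simps)

lemma bounded_bilinear_matrix_vector_mult:
  "bounded_bilinear ((*v) :: real^'m^'n \<Rightarrow> real^'m \<Rightarrow> real^'n)"
  unfolding bilinear_conv_bounded_bilinear[symmetric] bilinear_def
  by (auto intro!: linearI simp: matrix_vector_mult_add_rdistrib scaleR_matrix_vector_assoc
      matrix_vector_right_distrib matrix_vector_mult_scaleR)

lemmas bounded_linear_matrix_mult_right =
  bounded_bilinear.bounded_linear_right[OF bounded_bilinear_matrix_mult]
lemmas bounded_linear_matrix_mult_left =
  bounded_bilinear.bounded_linear_left[OF bounded_bilinear_matrix_mult]
lemmas bounded_linear_matrix_vector_left =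
  bounded_bilinear.bounded_linear_left[OF bounded_bilinear_matrix_vector_mult]
lemmas has_vector_derivative_matrix_vector =
  bounded_bilinear.has_vector_derivative[OF bounded_bilinear_matrix_vector_mult]

section \<open>The power series of \<open>rho\<close> and its derivative\<close>

abbreviation mpow :: "real^2^2 \<Rightarrow> nat \<Rightarrow> real^2^2" where
  "mpow B n \<equiv> ((**) B ^^ n) (mat 1)"

lemma mpow_scaleR: "mpow (s *\<^sub>R B) n = s ^ n *\<^sub>R mpow B n"
  by (induction n)
     (simp_all add: bounded_bilinear.scaleR_left[OF bounded_bilinear_matrix_mult]
       bounded_bilinear.scaleR_right[OF bounded_bilinear_matrix_mult])

text \<open>With \<open>K\<close> a bound for left multiplication by \<open>\<theta>\<close>, the
  series is dominated by a multiple of the real exponential series of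
  \<open>\<bar>s\<bar> * K\<close>.\<close>

lemma rho_sums: "(\<lambda>n. (s ^ n / fact n) *\<^sub>R mpow \<theta> n) sums rho \<theta> s"
proof -
  obtain K where K: "K > 0" "\<And>C :: real^2^2. norm (\<theta> ** C) \<le> norm C * K"
    using bounded_linear.pos_bounded[OF bounded_linear_matrix_mult_right[of \<theta>]] by blast
  have c: "norm (mpow \<theta> n) \<le> K ^ n * norm (mat 1 :: real^2^2)" for n
  proof (induction n)
    case (Suc n)
    have "norm (mpow \<theta> (Suc n)) \<le> norm (mpow \<theta> n) * K" using K(2) by simp
    also have "\<dots> \<le> (K ^ n * norm (mat 1 :: real^2^2)) * K"
      using Suc K(1) by (intro mult_right_mono) auto
    finally show ?case by (simp add: algebra_simps)
  qed simp
  have "summable (\<lambda>n. (s ^ n / fact n) *\<^sub>R mpow \<theta> n)"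
  proof (rule summable_comparison_test')
    show "summable (\<lambda>n. (inverse (fact n) * (\<bar>s\<bar> * K) ^ n) * norm (mat 1 :: real^2^2))"
      by (intro summable_mult2 summable_exp)
    fix n :: nat
    have "norm ((s ^ n / fact n) *\<^sub>R mpow \<theta> n) = (1 / fact n) * (\<bar>s\<bar> ^ n * norm (mpow \<theta> n))"
      by (simp add: power_abs)
    also have "\<dots> \<le> (1 / fact n) * (\<bar>s\<bar> ^ n * (K ^ n * norm (mat 1 :: real^2^2)))"
      using c[of n] by (intro mult_left_mono) auto
    finally show "norm ((s ^ n / fact n) *\<^sub>R mpow \<theta> n)
        \<le> (inverse (fact n) * (\<bar>s\<bar> * K) ^ n) * norm (mat 1 :: real^2^2)"
      by (simp add: power_mult_distrib field_simps)
  qed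
  then show ?thesis by (simp add: mexp_def mpow_scaleR summable_sums)
qed

lemma mult_rho_sums: "(\<lambda>n. (s ^ n / fact n) *\<^sub>R (A ** mpow \<theta> n)) sums (A ** rho \<theta> s)"
  using bounded_linear.sums[OF bounded_linear_matrix_mult_right[of A] rho_sums]
  by (simp add: bounded_bilinear.scaleR_right[OF bounded_bilinear_matrix_mult])

lemma rho_commute:
  assumes "A ** \<theta> = \<theta> ** A"
  shows "A ** rho \<theta> t = rho \<theta> t ** A"
proof -
  have "A ** mpow \<theta> n = mpow \<theta> n ** A" for n
  proof (induction n)
    case (Suc n)
    have "A ** (\<theta> ** mpow \<theta> n) = \<theta> ** (A ** mpow \<theta> n)" by (simp add: matrix_mul_assoc assms)
    then show ?case by (simp add: Suc matrix_mul_assoc)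
  qed simp
  moreover have "(\<lambda>n. (t ^ n / fact n) *\<^sub>R (mpow \<theta> n ** A)) sums (rho \<theta> t ** A)"
    using bounded_linear.sums[OF bounded_linear_matrix_mult_left[of A] rho_sums]
    by (simp add: bounded_bilinear.scaleR_left[OF bounded_bilinear_matrix_mult])
  ultimately show ?thesis using mult_rho_sums[where s = t and A = A and \<theta> = \<theta>] by (simp add: sums_unique2)
qed

text \<open>Each coordinate of \<open>rho \<theta>\<close> is an everywhere convergent real power
  series, which may be differentiated term by term.\<close>

lemma rho_has_vector_derivative: "(rho \<theta> has_vector_derivative \<theta> ** rho \<theta> t) (at t)"
  unfolding has_vector_derivative_def
proof (subst has_derivative_componentwise_within, intro ballI)
  fix i :: "real^2^2" assume "i \<in> Basis"
  define a where "a n = (mpow \<theta> n \<bullet> i) / fact n" for n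
  have a: "(\<lambda>n. a n * x ^ n) sums (rho \<theta> x \<bullet> i)" for x
    using bounded_linear.sums[OF bounded_linear_inner_left rho_sums[of x \<theta>], of i]
    by (simp add: a_def mult.commute)
  \<comment> \<open>The factor \<open>n + 1\<close> from differentiation cancels against the
    factorial, and the shifted index leaves one extra \<open>\<theta>\<close>.\<close>
  have "diffs a n * t ^ n = ((t ^ n / fact n) *\<^sub>R (\<theta> ** mpow \<theta> n)) \<bullet> i" for n
    by (simp add: diffs_def a_def field_simps del: of_nat_Suc)
  then have "(\<lambda>n. diffs a n * t ^ n) sums ((\<theta> ** rho \<theta> t) \<bullet> i)"
    using bounded_linear.sums[OF bounded_linear_inner_left mult_rho_sums[where s = t and A = \<theta> and \<theta> = \<theta>], of i] by simp
  moreover have "((\<lambda>x. \<Sum>n. a n * x ^ n) has_field_derivative (\<Sum>n. diffs a n * t ^ n)) (at t)"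
    by (rule termdiffs_strong_converges_everywhere) (use a in \<open>auto simp: summable_def\<close>)
  ultimately have "((\<lambda>x. rho \<theta> x \<bullet> i) has_field_derivative ((\<theta> ** rho \<theta> t) \<bullet> i)) (at t)"
    using sums_unique[OF a] sums_unique[of "\<lambda>n. diffs a n * t ^ n"] by simp
  then show "((\<lambda>x. rho \<theta> x \<bullet> i) has_derivative (\<lambda>h. (h *\<^sub>R (\<theta> ** rho \<theta> t)) \<bullet> i)) (at t)"
    by (simp add: has_real_derivative_iff_has_vector_derivative has_vector_derivative_def)
qed

lemma rho_vec_has_vector_derivative:
  "((\<lambda>t. rho \<theta> t *v w) has_vector_derivative \<theta> *v (rho \<theta> t *v w)) (at t)"
  using bounded_linear.has_vector_derivative[OF bounded_linear_matrix_vector_left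
      rho_has_vector_derivative]
  by (simp add: matrix_vector_mul_assoc)

lemma rho_uminus_has_vector_derivative:
  "((\<lambda>t. rho \<theta> (- t)) has_vector_derivative - (\<theta> ** rho \<theta> (- t))) (at t)"
proof -
  have "(uminus has_vector_derivative (- 1)) (at t)"
    by (auto intro!: derivative_eq_intros)
  from vector_diff_chain_at[OF this rho_has_vector_derivative] show ?thesis
    by (simp add: o_def scaleR_minus_left[of 1])
qed

text \<open>Since \<open>\<theta>\<close> commutes with its exponential, the two terms of the
  product rule cancel. The product is thus constant, with value \<open>mat 1\<close> at
  \<open>0\<close>.\<close>

lemma rho_uminus_mult: "rho \<theta> (- t) ** rho \<theta> t = mat 1"
proof -
  have "((\<lambda>t. rho \<theta> (- t) ** rho \<theta> t) has_vector_derivative 0) (at t)" for t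
  proof -
    have "rho \<theta> (- t) ** (\<theta> ** rho \<theta> t) = (\<theta> ** rho \<theta> (- t)) ** rho \<theta> t"
      using rho_commute[of \<theta> \<theta> "- t"] by (simp add: matrix_mul_assoc)
    then show ?thesis
      using bounded_bilinear.has_vector_derivative[OF bounded_bilinear_matrix_mult
          rho_uminus_has_vector_derivative[of \<theta> t] rho_has_vector_derivative[of \<theta> t]]
      by (simp add: bounded_bilinear.minus_left[OF bounded_bilinear_matrix_mult])
  qed
  then show ?thesis
    using eq_if_same_vector_derivative[of "\<lambda>t. rho \<theta> (- t) ** rho \<theta> t" "\<lambda>_. 0"
        "\<lambda>_. mat 1" 0 t]
    by simp
qed

lemma rho_uminus_vec [simp]: "rho \<theta> (- t) *v (rho \<theta> t *v w) = w"
  by (simp add: matrix_vector_mul_assoc rho_uminus_mult)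

lemma rho_vec_uminus [simp]: "rho \<theta> t *v (rho \<theta> (- t) *v w) = w"
  using rho_uminus_vec[of "- t" \<theta>] by simp

text \<open>The partial sums of the exponential series stay in \<open>S\<close>, and a subspace of
  finite dimension is closed.\<close>

lemma rho_vec_mem_invariant_subspace:
  assumes "subspace S" "\<And>x. x \<in> S \<Longrightarrow> \<theta> *v x \<in> S" "y \<in> S"
  shows "rho \<theta> t *v y \<in> S"
proof -
  have "mpow \<theta> n *v y \<in> S" for n
  proof (induction n)
    case (Suc n)
    then show ?case using assms(2)[of "mpow \<theta> n *v y"] by (simp add: matrix_vector_mul_assoc)
  qed (simp add: assms)
  then have "(\<Sum>n<N. ((t ^ n / fact n) *\<^sub>R mpow \<theta> n) *v y) \<in> S" for N
    using assms(1)
    by (auto intro!: subspace_sum subspace_scale simp: scaleR_matrix_vector_assoc[symmetric])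
  moreover have "(\<lambda>n. ((t ^ n / fact n) *\<^sub>R mpow \<theta> n) *v y) sums (rho \<theta> t *v y)"
    by (rule bounded_linear.sums[OF bounded_linear_matrix_vector_left rho_sums])
  ultimately show ?thesis
    unfolding sums_def by (rule closed_sequentially[OF closed_subspace[OF assms(1)]])
qed

section \<open>The integral \<open>Lam\<close>\<close>

lemma Lam_has_vector_derivative_at:
  "((\<lambda>t. Lam \<theta> t w) has_vector_derivative rho \<theta> t *v w) (at t)"
proof -
  \<comment> \<open>This radius gives an interval that contains the base point \<open>0\<close> and
    has \<open>t\<close> in its interior.\<close>
  define r where "r = \<bar>t\<bar> + 1"
  have "continuous_on {-r..r} (\<lambda>s. rho \<theta> s *v w)"
    by (intro bounded_linear.continuous_on[OF bounded_linear_matrix_vector_left] continuous_on_rho)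
  then have "((\<lambda>u. LBINT y=ereal 0..u. rho \<theta> y *v w) has_vector_derivative (rho \<theta> t *v w))
      (at t within {-r..r})"
    by (intro interval_integral_FTC2) (auto simp: r_def)
  moreover have "at t within {-r..r} = at t"
    by (rule at_within_interior) (auto simp: r_def)
  ultimately show ?thesis unfolding Lam_def by (simp only:)
qed

text \<open>Both sides have the same derivative and vanish at \<open>0\<close>. This also covers
  singular \<open>\<theta>\<close>, where \<open>Lam\<close> cannot be obtained by inverting
  \<open>\<theta>\<close>.\<close>

lemma theta_Lam: "\<theta> *v Lam \<theta> t w = rho \<theta> t *v w - w"
proof (rule eq_if_same_vector_derivative)
  show "((\<lambda>t. \<theta> *v Lam \<theta> t w) has_vector_derivative \<theta> *v (rho \<theta> t *v w)) (at t)" for t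
    by (rule bounded_linear.has_vector_derivative[OF matrix_vector_mul_bounded_linear
          Lam_has_vector_derivative_at])
  show "((\<lambda>t. rho \<theta> t *v w - w) has_vector_derivative \<theta> *v (rho \<theta> t *v w)) (at t)" for t
    using has_vector_derivative_diff[OF rho_vec_has_vector_derivative has_vector_derivative_const]
    by simp
  show "\<theta> *v Lam \<theta> 0 w = rho \<theta> 0 *v w - w" by (simp add: Lam_zero)
qed

text \<open>The product rule gives \<open>w\<close> from differentiating \<open>Lam\<close> and, by
  \<open>theta_Lam\<close>, \<open>- (w - rho \<theta> (- t) *v w)\<close> from differentiating
  \<open>rho\<close>.\<close>

lemma rho_uminus_Lam_has_vector_derivative:
  "((\<lambda>t. rho \<theta> (- t) *v Lam \<theta> t w) has_vector_derivative rho \<theta> (- t) *v w) (at t)"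
proof -
  have "\<theta> *v (rho \<theta> (- t) *v Lam \<theta> t w) = rho \<theta> (- t) *v (\<theta> *v Lam \<theta> t w)"
    using rho_commute[of \<theta> \<theta> "- t"] by (simp add: matrix_vector_mul_assoc)
  also have "\<dots> = w - rho \<theta> (- t) *v w"
    by (simp add: theta_Lam matrix_vector_mult_diff_distrib)
  finally have "(\<theta> ** rho \<theta> (- t)) *v Lam \<theta> t w = w - rho \<theta> (- t) *v w"
    by (simp add: matrix_vector_mul_assoc)
  then show ?thesis
    using has_vector_derivative_matrix_vector[OF rho_uminus_has_vector_derivative[of \<theta> t]
        Lam_has_vector_derivative_at[of \<theta> w t]]
    by (simp add: bounded_bilinear.minus_left[OF bounded_bilinear_matrix_vector_mult])
qed

lemma cayley_hamilton_2:
  fixes M :: "real^2^2"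
  shows "M *v (M *v v) = trace M *\<^sub>R (M *v v) - det M *\<^sub>R v"
  by (simp add: vec_eq_iff forall_2 matrix_vector_mult_def sum_2 trace_def det_2 algebra_simps)

text \<open>Bootstrapping: the derivative of \<open>rho\<close> is a linear image of
  \<open>rho\<close> itself, so order \<open>k\<close> yields order \<open>Suc k\<close>.\<close>

lemma Ck_on_rho_fst: "Ck_on k UNIV (\<lambda>p :: pt. rho \<theta> (fst p))"
proof (induction k)
  case 0
  show ?case
    using continuous_on_compose[of UNIV fst "rho \<theta>"] continuous_on_rho
    by (simp add: o_def continuous_on_fst)
next
  case (Suc k)
  then show ?case
    by (intro Ck_on_fst[OF rho_has_vector_derivative])
       (rule Ck_on_bounded_linear_compose[OF bounded_linear_matrix_mult_right open_UNIV])
qed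

lemma Ck_on_rho_uminus_fst: "Ck_on k UNIV (\<lambda>p :: pt. rho \<theta> (- fst p))"
proof -
  have "rho \<theta> (- t) = rho (- \<theta>) t" for t by (simp add: scaleR_minus_left)
  then show ?thesis using Ck_on_rho_fst[of k "- \<theta>"] by simp
qed


section \<open>Linear vector fields\<close>

text \<open>The term with the factor \<open>fst (X p)\<close> appears because the flow may move the
  first coordinate, on which the matrix \<open>rho\<close> in the product depends.\<close>

lemma linear_vector_field_gmult:
  assumes "linear_vector_field \<theta> X"
  shows "X (gmult \<theta> p q) = (fst (X p) + fst (X q),
    snd (X p) + (rho \<theta> (fst p) *v snd (X q) + fst (X p) *\<^sub>R (\<theta> *v (rho \<theta> (fst p) *v snd q))))"
proof -
  obtain \<phi> where fl: "global_flow X \<phi>" and aut: "\<And>s. lie_automorphism \<theta> (\<phi> s)"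
    using assms unfolding linear_vector_field_def by blast
  have d: "((\<lambda>s. \<phi> s r) has_vector_derivative X r) (at 0)" and z: "\<phi> 0 r = r" for r
    using fl unfolding global_flow_def by metis+
  have df: "((\<lambda>s. fst (\<phi> s r)) has_vector_derivative fst (X r)) (at 0)"
    and ds: "((\<lambda>s. snd (\<phi> s r)) has_vector_derivative snd (X r)) (at 0)" for r
    by (rule bounded_linear.has_vector_derivative[OF _ d] bounded_linear_fst bounded_linear_snd)+
  have dr: "((\<lambda>s. rho \<theta> (fst (\<phi> s p))) has_vector_derivative
      fst (X p) *\<^sub>R (\<theta> ** rho \<theta> (fst p))) (at 0)"
    using vector_diff_chain_at[OF df, of "rho \<theta>" _ p] rho_has_vector_derivative
    by (auto simp: o_def z)
  have "((\<lambda>s. gmult \<theta> (\<phi> s p) (\<phi> s q)) has_vector_derivative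
      (fst (X p) + fst (X q), snd (X p) + (rho \<theta> (fst (\<phi> 0 p)) *v snd (X q)
        + (fst (X p) *\<^sub>R (\<theta> ** rho \<theta> (fst p))) *v snd (\<phi> 0 q)))) (at 0)"
    unfolding gmult_def
    by (intro has_vector_derivative_Pair has_vector_derivative_add df ds
        has_vector_derivative_matrix_vector dr)
  moreover have "gmult \<theta> (\<phi> s p) (\<phi> s q) = \<phi> s (gmult \<theta> p q)" for s
    using aut[of s] unfolding lie_automorphism_def by metis
  ultimately have "((\<lambda>s. \<phi> s (gmult \<theta> p q)) has_vector_derivative
      (fst (X p) + fst (X q), snd (X p) + (rho \<theta> (fst p) *v snd (X q)
        + fst (X p) *\<^sub>R (\<theta> *v (rho \<theta> (fst p) *v snd q))))) (at 0)"
    by (simp add: z matrix_vector_mul_assoc scaleR_matrix_vector_assoc[symmetric])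
  from vector_derivative_unique_at[OF d this] show ?thesis .
qed

text \<open>The first basis vector is a witness for all three types.\<close>

lemma admissible_not_nilpotent:
  assumes "admissible \<theta>" obtains w where "\<theta> *v (\<theta> *v w) \<noteq> 0"
proof -
  define e :: "real^2" where "e = \<theta> *v (\<theta> *v axis 1 1)"
  have "e $ 1 \<noteq> 0 \<or> e $ 2 \<noteq> 0"
    using assms unfolding admissible_def
    by (elim disjE exE conjE) (auto simp: e_def matrix_vector_mult_def sum_2 axis_def)
  then have "e \<noteq> 0" by auto
  then show ?thesis using that by (simp add: e_def)
qed

text \<open>For invertible \<open>\<theta>\<close>, multiplying by the inverse and taking traces
  gives \<open>2 * a = 0\<close>. The only singular type is diagonal with entries \<open>1\<close>
  and \<open>0\<close>, of trace \<open>1\<close>, while commutators have trace zero. The proof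
  compares entries.\<close>

lemma admissible_commutator_multiple:
  assumes "admissible \<theta>" "A ** \<theta> = \<theta> ** A + a *\<^sub>R \<theta>"
  shows "a = 0"
proof -
  have e: "(A ** \<theta>) $ i $ j = (\<theta> ** A) $ i $ j + a * \<theta> $ i $ j" for i j
    by (simp add: assms(2))
  show ?thesis
    using assms(1) e[of 1 1] e[of 1 2] e[of 2 1] e[of 2 2] unfolding admissible_def
    by (elim disjE exE conjE) (simp_all add: matrix_matrix_mult_def sum_2)
qed

text \<open>As \<open>(t, v)\<close> is the product of \<open>(0, v)\<close> and
  \<open>(t, 0)\<close>, \<open>X\<close> is determined by its values on the two factors. Their
  components \<open>l\<close>, \<open>y\<close>, \<open>x\<close>, \<open>\<eta>\<close> are found
  in turn.\<close>

proposition linear_vector_field_imp_field_of: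
  assumes "admissible \<theta>" and X: "linear_vector_field \<theta> X"
  obtains \<xi> A where "A ** \<theta> = \<theta> ** A" "X = field_of \<theta> \<xi> A"
proof -
  have "Ck_on (Suc 0) UNIV X"
    using X unfolding linear_vector_field_def smooth_on_def by blast
  then have diff: "X differentiable (at p)" for p using Ck_on.simps(2) by blast
  have M1: "fst (X (gmult \<theta> p q)) = fst (X p) + fst (X q)"
    and M2: "snd (X (gmult \<theta> p q)) = snd (X p) +
      (rho \<theta> (fst p) *v snd (X q) + fst (X p) *\<^sub>R (\<theta> *v (rho \<theta> (fst p) *v snd q)))" for p q
    by (simp_all add: linear_vector_field_gmult[OF X])
  have g: "gmult \<theta> (0, v) (t, w) = (t, v + w)" "gmult \<theta> (t, 0) (s, w) = (t + s, rho \<theta> t *v w)"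
    for t s v w
    by (simp_all add: gmult_def)
  define l where "l v = fst (X (0, v))" for v
  define y where "y v = snd (X (0, v))" for v
  define x where "x t = fst (X (t, 0))" for t
  define \<eta> where "\<eta> t = snd (X (t, 0))" for t
  have dv: "(\<lambda>v. X (0, v)) differentiable (at v)" for v
    by (rule differentiable_compose[of X "\<lambda>v. (0, v)"] diff)+
       (auto simp: differentiable_def intro!: exI derivative_intros)
  have dt: "(\<lambda>t. X (t, 0)) differentiable (at t)" for t
    by (rule differentiable_compose[of X "\<lambda>t. (t, 0)"] diff)+
       (auto simp: differentiable_def intro!: exI derivative_intros)
  obtain D E where DE: "((\<lambda>v. X (0, v)) has_derivative D) (at 0)"
    "((\<lambda>t. X (t, 0)) has_derivative E) (at 0)"
    using dv[of 0] dt[of 0] unfolding differentiable_def by blast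
  have diffs: "l differentiable (at 0)" "y differentiable (at 0)"
    "x differentiable (at 0)" "\<eta> differentiable (at 0)"
    unfolding l_def y_def x_def \<eta>_def
    by (rule differentiableI has_derivative_fst has_derivative_snd DE)+
  have l_lin: "bounded_linear l"
    by (rule bounded_linear_if_additive_differentiable[OF _ diffs(1)])
       (metis M1 g(1) l_def)
  have l_theta: "l (\<theta> *v v) = 0" for v
  proof -
    \<comment> \<open>\<open>(t, 0) (0, v)\<close> and
      \<open>(0, rho \<theta> t *v v) (t, 0)\<close> are the same element, and the contribution of
      \<open>(t, 0)\<close> cancels.\<close>
    have "l (rho \<theta> t *v v) = l v" for t
      using M1[of "(t, 0)" "(0, v)"] M1[of "(0, rho \<theta> t *v v)" "(t, 0)"]
      unfolding g l_def by simp
    then have "((\<lambda>t. l (rho \<theta> t *v v)) has_vector_derivative 0) (at 0)" by simp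
    moreover have "((\<lambda>t. l (rho \<theta> t *v v)) has_vector_derivative l (\<theta> *v v)) (at 0)"
      using bounded_linear.has_vector_derivative[OF l_lin rho_vec_has_vector_derivative[of \<theta> v 0]]
      by simp
    ultimately show ?thesis by (rule vector_derivative_unique_at[rotated])
  qed
  have y_add: "y (v + w) = y v + y w + l v *\<^sub>R (\<theta> *v w)" for v w
    using M2[of "(0, v)" "(0, w)"] unfolding g y_def l_def by simp
  \<comment> \<open>Addition of vectors commutes, so the defect of additivity of \<open>y\<close>
    must be symmetric.\<close>
  then have l_sym: "l v *\<^sub>R (\<theta> *v w) = l w *\<^sub>R (\<theta> *v v)" for v w
    using y_add[of v w] y_add[of w v] by (simp add: add.commute)
  obtain w0 where w0: "\<theta> *v (\<theta> *v w0) \<noteq> 0" using assms(1) by (rule admissible_not_nilpotent)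
  have l0: "l v = 0" for v
    \<comment> \<open>Here the right side of \<open>l_sym\<close> vanishes by
      \<open>l_theta\<close>, whereas the vector on the left is nonzero.\<close>
    using l_sym[of v "\<theta> *v w0"] w0 by (simp add: l_theta)
  have y_lin: "bounded_linear y"
    by (rule bounded_linear_if_additive_differentiable[OF _ diffs(2)]) (simp add: y_add l0)
  define A where "A = matrix y"
  have yA: "y v = A *v v" for v
    using y_lin by (simp add: A_def bounded_linear.linear)
  have "bounded_linear x"
    by (rule bounded_linear_if_additive_differentiable[OF _ diffs(3)])
       (metis M1 g(2) x_def matrix_vector_mult_0_right)
  then have x: "x t = t * x 1" for t
    using linear_cmul[OF bounded_linear.linear, of x t 1] by simp
  \<comment> \<open>The same two factorizations as for \<open>l_theta\<close>, now compared in the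
    second component, where \<open>\<eta> t\<close> cancels.\<close>
  have comm: "A *v (rho \<theta> t *v v) = rho \<theta> t *v (A *v v) + (t * x 1) *\<^sub>R (\<theta> *v (rho \<theta> t *v v))"
    for t v
    using M2[of "(t, 0)" "(0, v)"] M2[of "(0, rho \<theta> t *v v)" "(t, 0)"]
    unfolding g by (simp add: l0[unfolded l_def] x_def x[of t, unfolded x_def]
        yA[unfolded y_def] algebra_simps)
  \<comment> \<open>Both sides of \<open>comm\<close> are differentiated at \<open>t = 0\<close>. In
    the last term only the derivative of the scalar factor survives.\<close>
  have "A *v (\<theta> *v v) = \<theta> *v (A *v v) + x 1 *\<^sub>R (\<theta> *v v)" for v
  proof (rule vector_derivative_unique_at)
    show "((\<lambda>t. A *v (rho \<theta> t *v v)) has_vector_derivative A *v (\<theta> *v v)) (at 0)"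
      using bounded_linear.has_vector_derivative[OF matrix_vector_mul_bounded_linear
          rho_vec_has_vector_derivative[of \<theta> v 0]] by simp
    have "((\<lambda>t. t * x 1) has_real_derivative x 1) (at 0)"
      by (auto intro!: derivative_eq_intros)
    then show "((\<lambda>t. A *v (rho \<theta> t *v v)) has_vector_derivative
        \<theta> *v (A *v v) + x 1 *\<^sub>R (\<theta> *v v)) (at 0)"
      using has_vector_derivative_add[OF rho_vec_has_vector_derivative[of \<theta> "A *v v" 0]
          has_vector_derivative_scaleR[OF _ bounded_linear.has_vector_derivative[OF
          matrix_vector_mul_bounded_linear[of \<theta>] rho_vec_has_vector_derivative[of \<theta> v 0]]]]
      by (fastforce simp: comm)
  qed
  then have AC: "A ** \<theta> = \<theta> ** A + x 1 *\<^sub>R \<theta>"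
    by (simp add: matrix_eq matrix_vector_mul_assoc[symmetric] matrix_vector_mult_add_rdistrib
        scaleR_matrix_vector_assoc[symmetric])
  then have x1: "x 1 = 0" using admissible_commutator_multiple[OF assms(1)] by blast
  have x0: "fst (X (t, 0)) = 0" for t using x[of t] x1 by (simp add: x_def)
  obtain \<xi> where xi: "(\<eta> has_vector_derivative \<xi>) (at 0)"
    using diffs(4) vector_derivative_works by blast
  \<comment> \<open>This cocycle identity determines the derivative of \<open>\<eta>\<close> at
    every \<open>s\<close> from the one at \<open>0\<close>, and at \<open>s = t = 0\<close> it
    forces \<open>\<eta> 0 = 0\<close>.\<close>
  have eta: "\<eta> (s + t) = \<eta> s + rho \<theta> s *v \<eta> t" for s t
    using M2[of "(s, 0)" "(t, 0)"] unfolding g \<eta>_def by simp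
  have "\<eta> t = Lam \<theta> t \<xi>" for t
  proof (rule eq_if_same_vector_derivative)
    show "(\<eta> has_vector_derivative rho \<theta> s *v \<xi>) (at s)" for s
    proof -
      have "((\<lambda>r. r - s) has_vector_derivative 1) (at s)"
        by (auto intro!: derivative_eq_intros)
      then have "((\<lambda>r. \<eta> (r - s)) has_vector_derivative \<xi>) (at s)"
        using vector_diff_chain_at[of "\<lambda>r. r - s" 1 s \<eta> \<xi>] xi by (simp add: o_def)
      from bounded_linear.has_vector_derivative[OF matrix_vector_mul_bounded_linear this]
      have "((\<lambda>r. \<eta> s + rho \<theta> s *v \<eta> (r - s)) has_vector_derivative rho \<theta> s *v \<xi>) (at s)"
        using has_vector_derivative_add[OF has_vector_derivative_const] by fastforce
      then show ?thesis by (simp add: eta[symmetric])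
    qed
    show "((\<lambda>t. Lam \<theta> t \<xi>) has_vector_derivative rho \<theta> s *v \<xi>) (at s)" for s
      by (rule Lam_has_vector_derivative_at)
    show "\<eta> 0 = Lam \<theta> 0 \<xi>" using eta[of 0 0] by (simp add: Lam_zero)
  qed
  then have "X (t, v) = field_of \<theta> \<xi> A (t, v)" for t v
    using M1[of "(0, v)" "(t, 0)"] M2[of "(0, v)" "(t, 0)"]
    unfolding g
    by (simp add: field_of_def prod_eq_iff x0 l0[unfolded l_def] yA[unfolded y_def] \<eta>_def)
  then have "X = field_of \<theta> \<xi> A" by auto
  then show ?thesis using that AC x1 by simp
qed


section \<open>The singular locus\<close>

lemma dim_2_eq_hyperplane:
  fixes \<Delta> :: "pt set"
  assumes "subspace \<Delta>" "dim \<Delta> = 2"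
  obtains N where "N \<noteq> 0" "\<Delta> = {x. N \<bullet> x = 0}"
proof -
  have D: "DIM(pt) = 3" by simp
  obtain N where N: "N \<noteq> 0" "span \<Delta> \<subseteq> {x. N \<bullet> x = 0}"
    using lowdim_subset_hyperplane[of \<Delta>] assms(2) D by auto
  have "\<Delta> = {x. N \<bullet> x = 0}"
    using N assms dim_hyperplane[OF N(1)] D
    by (intro subspace_dim_equal) (auto simp: subspace_hyperplane span_eq_iff[THEN iffD2])
  with N(1) show ?thesis by (rule that)
qed

text \<open>Linear fields are vertical, so this turns membership in the moving plane into membership
  in the fixed \<open>\<Delta>\<close>.\<close>

lemma mem_left_dist_vertical:
  "(0, z) \<in> left_dist \<theta> \<Delta> (t, v) \<longleftrightarrow> (0, rho \<theta> (- t) *v z) \<in> \<Delta>"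
  unfolding left_dist_eq by (auto intro!: exI[of _ "rho \<theta> (- t) *v z"])

lemma embedded_submanifold_transversal:
  fixes m :: "real^2"
  assumes "m \<noteq> 0" and c: "\<And>t. (c has_real_derivative m0 \<bullet> (rho \<theta> (- t) *v \<xi>)) (at t)"
  shows "embedded_submanifold {(t, v :: real^2). m \<bullet> (rho \<theta> (- t) *v v) + c t = 0}"
    (is "embedded_submanifold ?Z")
proof -
  have mm: "m \<bullet> m \<noteq> 0" using assms(1) by simp
  define W :: "pt set" where "W = {x. (0, m) \<bullet> x = 0}"
  \<comment> \<open>Scaled so that \<open>m \<bullet> d t = c t\<close>. The shift by
    \<open>d\<close> thereby absorbs \<open>c\<close> into the linear coordinate
    \<open>m \<bullet> snd (f p)\<close>.\<close>
  define d where "d t = (c t / (m \<bullet> m)) *\<^sub>R m" for t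
  define f :: "pt \<Rightarrow> pt" where "f p = (fst p, rho \<theta> (- fst p) *v snd p + d (fst p))" for p
  define h :: "pt \<Rightarrow> pt" where "h p = (fst p, rho \<theta> (fst p) *v (snd p + - d (fst p)))" for p
  have hf: "h (f p) = p" and fh: "f (h p) = p" for p by (simp_all add: f_def h_def)
  have "Ck_on k UNIV (\<lambda>p :: pt. c (fst p))" for k
  proof -
    have "Ck_on k UNIV (\<lambda>p :: pt. m0 \<bullet> (rho \<theta> (- fst p) *v \<xi>))"
      by (intro Ck_on_bounded_linear_compose[OF bounded_linear_inner_right]
          Ck_on_bounded_linear_compose[OF bounded_linear_matrix_vector_left]
          Ck_on_rho_uminus_fst open_UNIV)
    \<comment> \<open>The derivative of \<open>c\<close> is already known to be smooth, which makes
      \<open>c\<close> smooth as well.\<close>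
    then have "Ck_on (Suc k) UNIV (\<lambda>p :: pt. c (fst p))"
      by (intro Ck_on_fst[where F' = "\<lambda>t. m0 \<bullet> (rho \<theta> (- t) *v \<xi>)"])
         (use c in \<open>auto simp: has_real_derivative_iff_has_vector_derivative\<close>)
    then show ?thesis by (rule Ck_on_Suc_imp)
  qed
  then have "Ck_on k UNIV (\<lambda>p :: pt. (1 / (m \<bullet> m)) *\<^sub>R c (fst p))" for k
    by (intro Ck_on_bounded_linear_compose[OF bounded_linear_scaleR_right] open_UNIV)
  then have "Ck_on k UNIV (\<lambda>p :: pt. ((1 / (m \<bullet> m)) *\<^sub>R c (fst p)) *\<^sub>R m)" for k
    by (intro Ck_on_bounded_linear_compose[OF bounded_linear_scaleR_left] open_UNIV)
  then have Cd: "Ck_on k UNIV (\<lambda>p :: pt. d (fst p))" for k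
    by (simp add: d_def)
  have Cn: "Ck_on k UNIV (\<lambda>p :: pt. - d (fst p))" for k
    by (intro Ck_on_bounded_linear_compose[OF bounded_linear_minus[OF bounded_linear_ident]]
        open_UNIV Cd)
  note fst_snd = Ck_on_bounded_linear[OF bounded_linear_fst open_UNIV]
    Ck_on_bounded_linear[OF bounded_linear_snd open_UNIV]
  have "diffeomorphism_on UNIV UNIV f"
  proof (rule diffeomorphism_onI)
    show "surj f" using fh by (rule surjI)
    show "Ck_on k UNIV f" for k
      unfolding f_def
      by (intro Ck_on_Pair Ck_on_add Ck_on_bilinear[OF bounded_bilinear_matrix_vector_mult]
          fst_snd Cd Ck_on_rho_uminus_fst open_UNIV)
    show "Ck_on k UNIV h" for k
      unfolding h_def
      by (intro Ck_on_Pair Ck_on_add Ck_on_bilinear[OF bounded_bilinear_matrix_vector_mult]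
          fst_snd Cn Ck_on_rho_fst open_UNIV)
  qed (simp_all add: hf)
  moreover have "f ` ?Z = W"
  proof -
    have "p \<in> ?Z \<longleftrightarrow> f p \<in> W" for p
      using mm by (cases p) (simp add: f_def W_def d_def inner_add_right inner_Pair)
    then have "?Z = f -` W" by blast
    moreover have "surj f" using fh by (rule surjI)
    ultimately show ?thesis by (simp only: surj_image_vimage_eq)
  qed
  moreover have "subspace W" "dim W = 2"
    using dim_hyperplane[of "(0, m) :: pt"] assms(1)
    by (auto simp: W_def subspace_hyperplane zero_prod_def)
  ultimately have "embedded_submanifold_dim 2 ?Z"
    unfolding embedded_submanifold_dim_def
    by (intro ballI exI[of _ UNIV] exI[of _ f] exI[of _ W]) auto
  then show ?thesis unfolding embedded_submanifold_def by blast
qed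

text \<open>Near a point over \<open>a\<close>, the set is the single plane over \<open>a\<close>,
  which a translation moves to a linear subspace. Charts are required only at points of the set, so
  isolation at points of \<open>T\<close> suffices.\<close>

lemma embedded_submanifold_isolated_planes:
  fixes T :: "real set"
  assumes "\<And>a. a \<in> T \<Longrightarrow> eventually (\<lambda>t. t \<notin> T) (at a)"
  shows "embedded_submanifold (T \<times> (UNIV :: (real^2) set))"
proof -
  define W :: "pt set" where "W = {x. (1, 0) \<bullet> x = 0}"
  have W: "subspace W" "dim W = 2"
    using dim_hyperplane[of "(1, 0) :: pt"]
    by (auto simp: W_def subspace_hyperplane zero_prod_def)
  have "\<exists>U V (f :: pt \<Rightarrow> pt) W. open U \<and> p \<in> U \<and> open V \<and> diffeomorphism_on U V f \<and>
      subspace W \<and> dim W = 2 \<and> f ` ((T \<times> UNIV) \<inter> U) = V \<inter> W" if p: "p \<in> T \<times> UNIV" for p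
  proof -
    obtain a v0 where a: "p = (a, v0)" "a \<in> T" using p by auto
    obtain e where e: "e > 0" "\<And>t. t \<noteq> a \<Longrightarrow> dist t a < e \<Longrightarrow> t \<notin> T"
      using assms[OF a(2)] by (auto simp: eventually_at)
    define U V :: "pt set" where "U = ball a e \<times> UNIV" and "V = ball 0 e \<times> UNIV"
    define f h :: "pt \<Rightarrow> pt" where "f q = q + (- a, 0)" and "h q = q + (a, 0)" for q
    have fU: "f ` U = V"
    proof
      show "f ` U \<subseteq> V" by (auto simp: U_def V_def f_def dist_real_def)
      show "V \<subseteq> f ` U"
      proof
        fix q assume "q \<in> V"
        then have "h q \<in> U" "q = f (h q)"
          by (auto simp: U_def V_def f_def h_def dist_real_def zero_prod_def[symmetric])
        then show "q \<in> f ` U" by (rule rev_image_eqI)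
      qed
    qed
    have op: "open U" "open V" by (auto simp: U_def V_def intro: open_Times)
    have "diffeomorphism_on U V f"
    proof (rule diffeomorphism_onI[OF op(2) fU])
      show "h (f q) = q" for q by (simp add: f_def h_def add.assoc zero_prod_def[symmetric])
      show "Ck_on k U f" "Ck_on k V h" for k
        unfolding f_def h_def
        by (intro Ck_on_add Ck_on_const Ck_on_bounded_linear bounded_linear_ident op)+
    qed
    moreover have "f ` ((T \<times> UNIV) \<inter> U) = V \<inter> W"
    proof -
      have "(T \<times> UNIV) \<inter> U = {a} \<times> UNIV"
        using e a(2) by (force simp: U_def dist_commute)
      moreover have "V \<inter> W = {0} \<times> UNIV" using e(1) by (auto simp: V_def W_def)
      moreover have "f ` ({a} \<times> UNIV) = {0} \<times> UNIV" by (force simp: f_def)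
      ultimately show ?thesis by simp
    qed
    moreover have "p \<in> U" using e(1) a(1) by (simp add: U_def)
    ultimately show ?thesis using op W by blast
  qed
  then show ?thesis
    unfolding embedded_submanifold_def embedded_submanifold_dim_def by blast
qed

text \<open>At a zero of \<open>c\<close>, either \<open>c'\<close> or \<open>c''\<close> is
  nonzero, and Rolle descends from there to \<open>c\<close>. If both vanished, \<open>c'\<close>
  would vanish identically and \<open>c\<close> would be constant, against
  \<open>c b \<noteq> c a\<close>.\<close>

lemma isolated_zeros:
  assumes c: "\<And>t. (c has_real_derivative n \<bullet> (rho \<theta> (- t) *v \<xi>)) (at t)"
    and "c b \<noteq> 0" "c a = 0"
  shows "eventually (\<lambda>t. c t \<noteq> 0) (at a)"
proof -
  define c' where "c' t = n \<bullet> (rho \<theta> (- t) *v \<xi>)" for t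
  define c'' where "c'' t = - (n \<bullet> (\<theta> *v (rho \<theta> (- t) *v \<xi>)))" for t
  have ev: "eventually (\<lambda>t. u t \<noteq> 0) (at a)" if "isCont u a" "u a \<noteq> 0" for u :: "real \<Rightarrow> real"
    using that by (simp add: continuous_at tendsto_imp_eventually_ne)
  have dv: "((\<lambda>t. rho \<theta> (- t) *v \<xi>) has_vector_derivative - (\<theta> *v (rho \<theta> (- t) *v \<xi>))) (at t)"
    for t
    using bounded_linear.has_vector_derivative[OF bounded_linear_matrix_vector_left
        rho_uminus_has_vector_derivative[of \<theta> t]]
    by (simp add: matrix_vector_mul_assoc bounded_bilinear.minus_left[OF
          bounded_bilinear_matrix_vector_mult])
  have c': "(c' has_real_derivative c'' t) (at t)" for t
    using bounded_linear.has_vector_derivative[OF bounded_linear_inner_right dv, of n t]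
    by (simp add: has_real_derivative_iff_has_vector_derivative c'_def[abs_def] c''_def)
  have "isCont (\<lambda>t. rho \<theta> (- t) *v \<xi>) a"
    using dv by (rule has_vector_derivative_continuous)
  then have c''_cont: "isCont c'' a"
    unfolding c''_def
    by (intro continuous_intros bounded_linear.isCont[OF matrix_vector_mul_bounded_linear])
  show ?thesis
  proof (cases "c' a = 0")
    case False
    then have "eventually (\<lambda>t. c' t \<noteq> 0) (at a)" using ev DERIV_isCont[OF c'] by blast
    then show ?thesis
      using eventually_nonzero_if_deriv_nonzero[of c c'] c assms(3) by (simp add: c'_def)
  next
    case c'a: True
    have "c'' a \<noteq> 0"
    proof
      assume c''a: "c'' a = 0"
      \<comment> \<open>Vanishing of \<open>c'\<close> and \<open>c''\<close> at \<open>a\<close>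
        says exactly that \<open>rho \<theta> (- a) *v \<xi>\<close> lies in
        \<open>S\<close>.\<close>
      define S where "S = {z. n \<bullet> z = 0} \<inter> {z. n \<bullet> (\<theta> *v z) = 0}"
      have "subspace S"
        by (auto simp: S_def subspace_def inner_add_right matrix_vector_right_distrib
            matrix_vector_mult_scaleR)
      \<comment> \<open>By Cayley-Hamilton, \<open>n \<bullet> (\<theta> *v (\<theta> *v z))\<close>
        is a combination of the two quantities that vanish on \<open>S\<close>.\<close>
      moreover have "\<theta> *v z \<in> S" if "z \<in> S" for z
        using that by (simp add: S_def cayley_hamilton_2 inner_diff_right)
      moreover have "rho \<theta> (- a) *v \<xi> \<in> S" using c'a c''a by (simp add: S_def c'_def c''_def)
      ultimately have S: "rho \<theta> s *v (rho \<theta> (- a) *v \<xi>) \<in> S" for s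
        by (rule rho_vec_mem_invariant_subspace)
      \<comment> \<open>The choice \<open>s = a\<close> undoes \<open>rho \<theta> (- a)\<close>.
        The whole orbit of \<open>\<xi>\<close> then stays in \<open>S\<close>.\<close>
      then have "\<xi> \<in> S" using rho_vec_uminus by metis
      then have "n \<bullet> (rho \<theta> (- t) *v \<xi>) = 0" for t
        using rho_vec_mem_invariant_subspace[OF \<open>subspace S\<close> \<open>\<And>z. z \<in> S \<Longrightarrow> \<theta> *v z \<in> S\<close>]
        by (simp add: S_def)
      then have "(c has_vector_derivative 0) (at t)" for t
        using c[of t] by (simp add: has_real_derivative_iff_has_vector_derivative)
      then have "c b = c a"
        using eq_if_same_vector_derivative[of c "\<lambda>_. 0" "\<lambda>_. c a" a b] by simp
      then show False using assms by simp
    qed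
    then have "eventually (\<lambda>t. c'' t \<noteq> 0) (at a)" using ev[OF c''_cont] by blast
    then have "eventually (\<lambda>t. c' t \<noteq> 0) (at a)"
      using eventually_nonzero_if_deriv_nonzero[of c' c''] c' c'a by blast
    then show ?thesis
      using eventually_nonzero_if_deriv_nonzero[of c c'] c assms(3) by (simp add: c'_def)
  qed
qed

theorem theorem4p1:
  fixes \<theta> :: "real^2^2"
    and X :: "real \<times> (real^2) \<Rightarrow> real \<times> (real^2)"
    and \<Delta> :: "(real \<times> (real^2)) set"
    and g :: "real \<times> (real^2) \<Rightarrow> real \<times> (real^2) \<Rightarrow> real \<times> (real^2) \<Rightarrow> real"
  assumes "admissible \<theta>"
    and "simple_ARS \<theta> X \<Delta> g"
  shows "embedded_submanifold (singular_locus \<theta> X \<Delta>)"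
proof -
  have ars: "linear_vector_field \<theta> X" "subspace \<Delta>" "dim \<Delta> = 2"
    "{p. X p \<notin> left_dist \<theta> \<Delta> p} \<noteq> {}"
    using assms(2) unfolding simple_ARS_def by auto
  obtain \<xi> A where AC: "A ** \<theta> = \<theta> ** A" and X: "X = field_of \<theta> \<xi> A"
    using linear_vector_field_imp_field_of[OF assms(1) ars(1)] .
  obtain N where "\<Delta> = {x. N \<bullet> x = 0}"
    using dim_2_eq_hyperplane[OF ars(2,3)] by metis
  then obtain n0 n where \<Delta>: "\<Delta> = {x. (n0, n) \<bullet> x = 0}" by (metis surj_pair)
  define m where "m = transpose A *v n"
  define c where "c t = n \<bullet> (rho \<theta> (- t) *v Lam \<theta> t \<xi>)" for t
  have c: "(c has_real_derivative n \<bullet> (rho \<theta> (- t) *v \<xi>)) (at t)" for t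
    using bounded_linear.has_vector_derivative[OF bounded_linear_inner_right
        rho_uminus_Lam_has_vector_derivative]
    by (simp add: has_real_derivative_iff_has_vector_derivative c_def[abs_def])
  have mem: "X (t, v) \<in> left_dist \<theta> \<Delta> (t, v) \<longleftrightarrow> m \<bullet> (rho \<theta> (- t) *v v) + c t = 0" for t v
  proof -
    \<comment> \<open>Commuting \<open>A\<close> past \<open>rho\<close> lets its transpose act on
      \<open>n\<close>, which produces \<open>m\<close>.\<close>
    have "rho \<theta> (- t) *v (A *v v) = A *v (rho \<theta> (- t) *v v)"
      using rho_commute[OF AC, of "- t"] by (simp add: matrix_vector_mul_assoc)
    then show ?thesis
      by (simp add: X field_of_def mem_left_dist_vertical \<Delta> m_def c_def matrix_vector_right_distrib
          inner_add_right dot_lmul_matrix[symmetric])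
  qed
  then have Z: "singular_locus \<theta> X \<Delta> = {(t, v). m \<bullet> (rho \<theta> (- t) *v v) + c t = 0}"
    by (auto simp: singular_locus_def)
  show ?thesis
  proof (cases "m = 0")
    case False
    then show ?thesis unfolding Z using c by (rule embedded_submanifold_transversal)
  next
    case True
    then have "singular_locus \<theta> X \<Delta> = {t. c t = 0} \<times> UNIV" by (auto simp: Z)
    \<comment> \<open>A point off the locus exists by condition (i). For \<open>m = 0\<close>, its
      first coordinate is a time at which \<open>c\<close> is nonzero.\<close>
    moreover obtain b where "c b \<noteq> 0" using ars(4) mem True by auto
    ultimately show ?thesis
      using isolated_zeros[OF c] by (auto intro: embedded_submanifold_isolated_planes)
  qed
qed

end
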